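(* Let $\psi:\tilde I\to I$ be a continuously differentiable function with $\psi'>0$, mapping an interval $\tilde I$ with endpoints $\tilde a$ and $\tilde b$ onto the interval $I$ (one-sided derivatives being used at endpoints belonging to $\tilde I$). Let $\tilde{\mathbf w}=(\tilde w_0,\tilde w_1,\dots)$, where $\tilde w_0=w_0\circ\psi$ and $\tilde w_j=(w_j\circ\psi)\,\psi'$ for $j\ge1$. Then for each integer $j\ge0$ the following holds: (I) for each $f\in\mathcal S_{\mathbf w}^j$ one has $f\circ\psi\in\mathcal S_{\tilde{\mathbf w}}^j$ and $(f\circ\psi)^{(j)}_{\tilde{\mathbf w}}=f^{(j)}_{\mathbf w}\circ\psi$; (II) the map $\mathcal S_{\mathbf w}^j\ni f\mapsto f\circ\psi\in\mathcal S_{\tilde{\mathbf w}}^j$ is bijective.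
   Context: For any interval $I\subseteq\mathbb R$ of nonzero length with $b=\sup I$: $\mathcal B$ is the set of Borel-measurable functions $I\to\mathbb R$; $\mathcal B^+=\{w\in\mathcal B: w>0\}$. $\mathcal{RC}$ is the set of functions $I\to\mathbb R$ that are right-continuous on $I\setminus\{b\}$ and, if $b\in I$, left-continuous at $b$. For $w\in\mathcal B^+$, $\mathcal{RC}_w=\{f\in\mathcal B: f/w\in\mathcal{RC}\}$, and $\mathcal S_w$ is the set of $f\in\mathcal B$ for which there is a function $D_wf\in\mathcal{RC}_w$ (necessarily unique) with $f(x)=f(z)+\int_z^x(D_wf)(u)\,du$ for all $x,z\in I$ (with $\int_z^x=-\int_x^z$ if $x<z$). $\mathbf w=(w_0,w_1,\dots)$ is a sequence of (gauge) functions in $\mathcal B^+$, each bounded on every compact subset of $I$. Put $\mathcal S^0_{\mathbf w}=\mathcal B$, $f^{(0)}_{\mathbf w}=f/w_0$, and recursively for $j\ge1$: $\mathcal S^j_{\mathbf w}=\{f\in\mathcal S^{j-1}_{\mathbf w}: f^{(j-1)}_{\mathbf w}\in\mathcal S_{w_j}\}$ and $f^{(j)}_{\mathbf w}=(D_{w_j}f^{(j-1)}_{\mathbf w})/w_j$ for $f\in\mathcal S^j_{\mathbf w}$. The objects $\mathcal S_{\tilde{\mathbf w}}^j$ and $g^{(j)}_{\tilde{\mathbf w}}$ are defined in the same way on the interval $\tilde I$ with the gauge functions $\tilde{\mathbf w}$. *)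

theory Defs
  imports "HOL-Analysis.Analysis" "HOL-Library.FuncSet"
begin

text \<open>
  A function \<open>I \<rightarrow> \<real>\<close> is represented by its extensional representative
  (\<open>undefined\<close> outside \<open>I\<close>), so that equality in HOL is equality of functions on \<open>I\<close>.
\<close>

definition nondegenerate_interval :: "real set \<Rightarrow> bool" where
  "nondegenerate_interval I \<longleftrightarrow> is_interval I \<and> (\<exists>x\<in>I. \<exists>y\<in>I. x < y)"

definition borel_funs :: "real set \<Rightarrow> (real \<Rightarrow> real) set" where
  "borel_funs I = {f \<in> extensional I. f \<in> borel_measurable (restrict_space borel I)}"

definition borel_funs_pos :: "real set \<Rightarrow> (real \<Rightarrow> real) set" where
  "borel_funs_pos I = {w \<in> borel_funs I. \<forall>x\<in>I. w x > 0}"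

text \<open>
  The supremum is taken in the extended reals since \<open>I\<close> may be unbounded. For an interval
  \<open>I\<close>, the one-sided filters below eventually stay inside \<open>I\<close>, so the values outside \<open>I\<close>
  are irrelevant.
\<close>

definition rc_funs :: "real set \<Rightarrow> (real \<Rightarrow> real) set" where
  "rc_funs I = {f \<in> extensional I. \<forall>x\<in>I.
     if ereal x = (SUP y\<in>I. ereal y) then continuous (at_left x) f
     else continuous (at_right x) f}"

definition rc_funs_wrt :: "real set \<Rightarrow> (real \<Rightarrow> real) \<Rightarrow> (real \<Rightarrow> real) set" where
  "rc_funs_wrt I w = {f \<in> borel_funs I. (\<lambda>x\<in>I. f x / w x) \<in> rc_funs I}"

text \<open>
  Integrability is stated explicitly because the Bochner integral of a non-integrable
  function is \<open>0\<close>. The interval integral has the convention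
  \<open>\<integral>\<^sub>z\<^sup>x = - \<integral>\<^sub>x\<^sup>z\<close> for \<open>x < z\<close> built in.
\<close>

definition is_D_wrt ::
  "real set \<Rightarrow> (real \<Rightarrow> real) \<Rightarrow> (real \<Rightarrow> real) \<Rightarrow> (real \<Rightarrow> real) \<Rightarrow> bool" where
  "is_D_wrt I w f g \<longleftrightarrow> g \<in> rc_funs_wrt I w \<and>
     (\<forall>x\<in>I. \<forall>z\<in>I.
        interval_lebesgue_integrable lborel (ereal z) (ereal x) g \<and>
        f x = f z + (LBINT u=ereal z..ereal x. g u))"

definition S_wrt :: "real set \<Rightarrow> (real \<Rightarrow> real) \<Rightarrow> (real \<Rightarrow> real) set" where
  "S_wrt I w = {f \<in> borel_funs I. \<exists>g. is_D_wrt I w f g}"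

definition D_wrt :: "real set \<Rightarrow> (real \<Rightarrow> real) \<Rightarrow> (real \<Rightarrow> real) \<Rightarrow> (real \<Rightarrow> real)" where
  "D_wrt I w f = (THE g. is_D_wrt I w f g)"

definition gauge_seq :: "real set \<Rightarrow> (nat \<Rightarrow> real \<Rightarrow> real) \<Rightarrow> bool" where
  "gauge_seq I w \<longleftrightarrow> (\<forall>j. w j \<in> borel_funs_pos I \<and>
     (\<forall>K. compact K \<and> K \<subseteq> I \<longrightarrow> bounded (w j ` K)))"

text \<open>
  \<open>gen_deriv I w j f\<close> is \<open>f\<^sup>(\<^sup>j\<^sup>)\<close> with respect to the gauge functions \<open>w\<close>; it is
  meaningful only for \<open>f \<in> gen_S I w j\<close>.
\<close>

primrec gen_deriv ::
  "real set \<Rightarrow> (nat \<Rightarrow> real \<Rightarrow> real) \<Rightarrow> nat \<Rightarrow> (real \<Rightarrow> real) \<Rightarrow> (real \<Rightarrow> real)" where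
  "gen_deriv I w 0 f = (\<lambda>x\<in>I. f x / w 0 x)"
| "gen_deriv I w (Suc j) f =
     (\<lambda>x\<in>I. D_wrt I (w (Suc j)) (gen_deriv I w j f) x / w (Suc j) x)"

primrec gen_S ::
  "real set \<Rightarrow> (nat \<Rightarrow> real \<Rightarrow> real) \<Rightarrow> nat \<Rightarrow> (real \<Rightarrow> real) set" where
  "gen_S I w 0 = borel_funs I"
| "gen_S I w (Suc j) = {f \<in> gen_S I w j. gen_deriv I w j f \<in> S_wrt I (w (Suc j))}"

end

theory Submission
  imports Defs
begin

text \<open>
  By the change of variables formula, if \<open>g\<close> is the generalized derivative of \<open>f\<close> with respect
  to \<open>w\<close>, then \<open>(g \<circ> \<psi>) \<psi>'\<close> is that of \<open>f \<circ> \<psi>\<close> with respect to \<open>(w \<circ> \<psi>) \<psi>'\<close>. The factor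
  \<open>\<psi>'\<close> cancels in the quotient by the gauge function, so induction on \<open>j\<close> gives (I). Applying (I)
  to \<open>\<psi>\<inverse>\<close>, which transports the new gauge functions back to the old ones, gives (II).
\<close>

section \<open>One-sided continuity on an interval\<close>

text \<open>One filter covers both cases of \<open>rc_funs\<close>, so that membership becomes a
  limit statement open to the filter calculus.\<close>

definition inward :: "real set \<Rightarrow> real \<Rightarrow> real filter" where
  "inward I x = (if ereal x = (SUP y\<in>I. ereal y) then at_left x else at_right x)"

text \<open>Replaces the extended-real supremum by a pure order condition, which an increasing
  bijection transports directly.\<close>

lemma ereal_eq_SUP_iff:
  assumes "x \<in> I"
  shows "ereal x = (SUP y\<in>I. ereal y) \<longleftrightarrow> (\<forall>y\<in>I. y \<le> x)"
proof
  assume eq: "ereal x = (SUP y\<in>I. ereal y)"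
  show "\<forall>y\<in>I. y \<le> x"
  proof
    fix y assume "y \<in> I"
    then have "ereal y \<le> (SUP y\<in>I. ereal y)" by (rule SUP_upper)
    then show "y \<le> x" unfolding eq[symmetric] by simp
  qed
next
  assume "\<forall>y\<in>I. y \<le> x"
  then show "ereal x = (SUP y\<in>I. ereal y)"
    using assms by (intro antisym SUP_upper SUP_least) auto
qed

lemma inward_eq:
  "x \<in> I \<Longrightarrow> inward I x = (if \<forall>y\<in>I. y \<le> x then at_left x else at_right x)"
  by (simp add: inward_def ereal_eq_SUP_iff)

lemma rc_funs_iff:
  "f \<in> rc_funs I \<longleftrightarrow> f \<in> extensional I \<and> (\<forall>x\<in>I. (f \<longlongrightarrow> f x) (inward I x))"
  by (auto simp: rc_funs_def inward_def continuous_within)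

lemma nondegenerate_interval_Icc_subset:
  "nondegenerate_interval I \<Longrightarrow> p \<in> I \<Longrightarrow> q \<in> I \<Longrightarrow> {p..q} \<subseteq> I"
  unfolding nondegenerate_interval_def is_interval_1 by (meson atLeastAtMost_iff subsetI)

lemma nondegenerate_interval_not_last:
  assumes "nondegenerate_interval I" "x \<in> I" "\<forall>y\<in>I. y \<le> x"
  obtains p where "p \<in> I" "p < x"
  using assms unfolding nondegenerate_interval_def by (metis less_le_trans)

text \<open>Extracts from a one-sided neighbourhood an open interval of positive length with
  endpoints in \<open>I\<close>, as needed to use the integral identity in
  \<open>is_D_wrt\<close>.\<close>

lemma eventually_inwardE:
  assumes I: "nondegenerate_interval I" and x: "x \<in> I" and P: "eventually P (inward I x)"
  obtains p q where "p \<in> I" "q \<in> I" "p < q" "\<And>y. p < y \<Longrightarrow> y < q \<Longrightarrow> P y"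
proof (cases "\<forall>y\<in>I. y \<le> x")
  case True
  then obtain p where p: "p \<in> I" "p < x"
    using nondegenerate_interval_not_last[OF I x] by blast
  from True P have "eventually P (at_left x)" by (simp add: inward_eq x)
  then obtain b where b: "b < x" "\<And>y. b < y \<Longrightarrow> y < x \<Longrightarrow> P y"
    unfolding eventually_at_left_field by blast
  \<comment> \<open>The bound \<open>b\<close> may lie outside \<open>I\<close>; the maximum with
    \<open>p\<close> brings the left endpoint back into \<open>I\<close>.\<close>
  have "max p b \<in> I"
    using nondegenerate_interval_Icc_subset[OF I p(1) x] p b by auto
  then show ?thesis using that[of "max p b" x] x p b by auto
next
  case False
  then obtain p where p: "p \<in> I" "x < p" by force
  from False P have "eventually P (at_right x)" by (simp only: inward_eq x if_False)
  then obtain b where b: "b > x" "\<And>y. x < y \<Longrightarrow> y < b \<Longrightarrow> P y"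
    unfolding eventually_at_right_field by blast
  have "min p b \<in> I"
    using nondegenerate_interval_Icc_subset[OF I x p(1)] p b by auto
  then show ?thesis using that[of x "min p b"] x p b by auto
qed

text \<open>This justifies ignoring values outside \<open>I\<close> in one-sided limits, so
  functions may be replaced by their extensional representatives.\<close>

lemma eventually_inward_mem:
  assumes I: "nondegenerate_interval I" and x: "x \<in> I"
  shows "eventually (\<lambda>y. y \<in> I) (inward I x)"
proof (cases "\<forall>y\<in>I. y \<le> x")
  case True
  then obtain p where p: "p \<in> I" "p < x"
    using nondegenerate_interval_not_last[OF I x] by blast
  have "eventually (\<lambda>y. y \<in> {p<..<x}) (at_left x)"
    using p(2) by (rule eventually_at_leftI[rotated]) simp
  moreover have "{p<..<x} \<subseteq> I"
    using nondegenerate_interval_Icc_subset[OF I p(1) x] by force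
  ultimately have "eventually (\<lambda>y. y \<in> I) (at_left x)"
    by (meson eventually_mono subsetD)
  then show ?thesis using True x by (simp add: inward_eq)
next
  case False
  then obtain p where p: "p \<in> I" "x < p" by force
  have "eventually (\<lambda>y. y \<in> {x<..<p}) (at_right x)"
    using p(2) by (rule eventually_at_rightI[rotated]) simp
  moreover have "{x<..<p} \<subseteq> I"
    using nondegenerate_interval_Icc_subset[OF I x p(1)] by force
  ultimately have "eventually (\<lambda>y. y \<in> I) (at_right x)"
    by (meson eventually_mono subsetD)
  then show ?thesis using False x by (simp only: inward_eq if_False)
qed

lemma inward_le:
  assumes "nondegenerate_interval I" "x \<in> I"
  shows "inward I x \<le> at x within I"
proof -
  have "inward I x \<le> at x"
    by (simp add: inward_def at_le)
  moreover have "inward I x \<le> principal I"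
    using eventually_inward_mem[OF assms] by (simp add: le_principal)
  moreover have "at x within I = inf (at x) (principal I)"
    by (simp add: at_within_def inf_assoc inf_principal Int_commute Diff_eq)
  ultimately show ?thesis by simp
qed

section \<open>Uniqueness of the generalized derivative\<close>

lemma set_borel_measurable_borel_funs:
  assumes "g \<in> borel_funs I" "A \<in> sets borel" "A \<subseteq> I"
  shows "set_borel_measurable borel A g"
proof -
  have "g \<in> borel_measurable (restrict_space borel I)"
    using assms(1) by (simp add: borel_funs_def)
  then have "g \<in> borel_measurable (restrict_space borel A)"
    using assms(3) by (rule measurable_restrict_mono)
  moreover have "A \<inter> space borel \<in> sets borel" using assms(2) by simp
  ultimately show ?thesis
    unfolding set_borel_measurable_def using borel_measurable_restrict_space_iff by blast
qed

text \<open>A nonnegative integrand with zero integral vanishes almost everywhere; here that would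
  make a nonempty open interval a null set.\<close>

lemma set_integral_pos_Ioo:
  fixes h :: "real \<Rightarrow> real"
  assumes "p < q" "set_integrable lborel {p<..<q} h" "\<And>y. p < y \<Longrightarrow> y < q \<Longrightarrow> h y > 0"
  shows "(LINT y:{p<..<q}|lborel. h y) > 0"
proof -
  let ?k = "\<lambda>y. indicator {p<..<q} y *\<^sub>R h y"
  have int: "integrable lborel ?k" using assms(2) by (simp add: set_integrable_def)
  have nn: "AE y in lborel. 0 \<le> ?k y"
    using assms(3) by (intro AE_I2) (auto simp: indicator_def intro: less_imp_le)
  have "integral\<^sup>L lborel ?k \<noteq> 0"
  proof
    assume "integral\<^sup>L lborel ?k = 0"
    then have "AE y in lborel. ?k y = 0"
      using integral_nonneg_eq_0_iff_AE[OF int nn] by simp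
    then have "AE y in lborel. y \<notin> {p<..<q}"
      by (rule AE_mp) (use assms(3) in \<open>force intro!: AE_I2\<close>)
    then have "{p<..<q} \<in> null_sets lborel"
      by (simp add: AE_iff_null_sets)
    then show False using assms(1) by (simp add: null_sets_def)
  qed
  moreover have "integral\<^sup>L lborel ?k \<ge> 0" using nn by (rule integral_nonneg_AE)
  ultimately show ?thesis by (simp add: set_lebesgue_integral_def)
qed

lemma is_D_wrt_integral:
  assumes "is_D_wrt I w f g" "p \<in> I" "q \<in> I" "p \<le> q"
  shows "set_integrable lborel {p<..<q} g" and "f q - f p = (LINT y:{p<..<q}|lborel. g y)"
proof -
  have "interval_lebesgue_integrable lborel (ereal p) (ereal q) g"
    "f q = f p + (LBINT u=ereal p..ereal q. g u)"
    using assms(1-3) unfolding is_D_wrt_def by blast+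
  then show "set_integrable lborel {p<..<q} g" "f q - f p = (LINT y:{p<..<q}|lborel. g y)"
    using assms(4)
    by (simp_all add: interval_lebesgue_integrable_def interval_lebesgue_integral_def)
qed

text \<open>If \<open>g x > h x\<close>, the inward limit of \<open>g / w - h / w\<close> at
  \<open>x\<close> is positive, so \<open>g > h\<close> on some interval between points
  \<open>p < q\<close> of \<open>I\<close>. Both functions have integral \<open>f q - f p\<close>
  there, a contradiction. One-sided continuity thus upgrades almost-everywhere agreement to
  agreement at every point.\<close>

lemma is_D_wrt_le:
  assumes I: "nondegenerate_interval I" and w: "\<And>x. x \<in> I \<Longrightarrow> w x > 0"
    and g: "is_D_wrt I w f g" and h: "is_D_wrt I w f h" and x: "x \<in> I"
  shows "g x \<le> h x"
proof (rule ccontr)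
  assume "\<not> g x \<le> h x"
  define G where "G = (\<lambda>x\<in>I. g x / w x)"
  define H where "H = (\<lambda>x\<in>I. h x / w x)"
  have "(G \<longlongrightarrow> G x) (inward I x)" "(H \<longlongrightarrow> H x) (inward I x)"
    using g h x unfolding is_D_wrt_def rc_funs_wrt_def rc_funs_iff G_def H_def by blast+
  then have "((\<lambda>y. G y - H y) \<longlongrightarrow> G x - H x) (inward I x)" by (rule tendsto_diff)
  moreover have "G x - H x > 0"
    using \<open>\<not> g x \<le> h x\<close> x w[OF x] by (simp add: G_def H_def divide_strict_right_mono)
  ultimately have "eventually (\<lambda>y. G y - H y > 0) (inward I x)"
    by (rule order_tendstoD)
  then obtain p q where pq: "p \<in> I" "q \<in> I" "p < q"
    and pos: "\<And>y. p < y \<Longrightarrow> y < q \<Longrightarrow> G y - H y > 0"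
    by (rule eventually_inwardE[OF I x]) blast
  have "g y - h y > 0" if "p < y" "y < q" for y
  proof -
    have "y \<in> I" using nondegenerate_interval_Icc_subset[OF I pq(1,2)] that by auto
    then show ?thesis
      using pos[OF that] w[of y] by (simp add: G_def H_def divide_less_cancel)
  qed
  moreover note ints = is_D_wrt_integral[OF g pq(1,2)] is_D_wrt_integral[OF h pq(1,2)]
  ultimately have "(LINT y:{p<..<q}|lborel. g y - h y) > 0"
    using pq by (intro set_integral_pos_Ioo set_integral_diff) auto
  then show False using ints pq by (simp add: set_integral_diff)
qed

lemma is_D_wrt_unique:
  assumes "nondegenerate_interval I" "\<And>x. x \<in> I \<Longrightarrow> w x > 0"
    and "is_D_wrt I w f g" "is_D_wrt I w f h"
  shows "g = h"
proof (rule extensionalityI)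
  show "g \<in> extensional I" "h \<in> extensional I"
    using assms(3,4) unfolding is_D_wrt_def rc_funs_wrt_def borel_funs_def by blast+
  show "g x = h x" if "x \<in> I" for x
    using is_D_wrt_le[OF assms(1,2) assms(3,4) that] is_D_wrt_le[OF assms(1,2) assms(4,3) that]
    by simp
qed

text \<open>Uniqueness makes the definite description in \<open>D_wrt\<close> computable from any
  witness.\<close>

lemma D_wrt_eqI:
  assumes "nondegenerate_interval I" "\<And>x. x \<in> I \<Longrightarrow> w x > 0" "is_D_wrt I w f g"
  shows "D_wrt I w f = g"
  unfolding D_wrt_def
proof (rule the_equality)
  fix h assume "is_D_wrt I w f h"
  with assms show "h = g" by (intro is_D_wrt_unique[of I w f h g])
qed (fact assms(3))

lemma gen_S_subset_borel_funs: "gen_S I w j \<subseteq> borel_funs I"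
  by (induction j) auto

section \<open>Change of variables\<close>

text \<open>The substitution formula for absolutely integrable functions refers to Lebesgue measure,
  the completion of \<open>lborel\<close>. Borel measurability, assumed in \<open>meas\<close>,
  brings its conclusion back to \<open>lborel\<close>.\<close>

lemma set_integral_change_of_variables:
  fixes f g g' :: "real \<Rightarrow> real"
  assumes S: "S \<in> sets borel" and gS: "g ` S \<in> sets borel"
    and deriv: "\<And>x. x \<in> S \<Longrightarrow> (g has_field_derivative g' x) (at x within S)"
    and nonneg: "\<And>x. x \<in> S \<Longrightarrow> g' x \<ge> 0"
    and inj: "inj_on g S"
    and int: "set_integrable lborel (g ` S) f"
    and meas: "set_borel_measurable borel S (\<lambda>x. f (g x) * g' x)"
  shows "set_integrable lborel S (\<lambda>x. f (g x) * g' x)"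
    and "(LINT x:S|lborel. f (g x) * g' x) = (LINT y:g ` S|lborel. f y)"
proof -
  have f: "f absolutely_integrable_on g ` S"
    using int unfolding set_integrable_def by (simp add: integrable_completion)
  have cong: "\<bar>g' x\<bar> * f (g x) = f (g x) * g' x" if "x \<in> S" for x
    using nonneg[OF that] by simp
  have "S \<in> sets lebesgue" using S by simp
  from has_absolute_integral_change_of_variables_1'[OF this deriv inj,
      of f "integral (g ` S) f"] f
  have *: "(\<lambda>x. \<bar>g' x\<bar> * f (g x)) absolutely_integrable_on S"
    "integral S (\<lambda>x. \<bar>g' x\<bar> * f (g x)) = integral (g ` S) f"
    by auto
  from *(1) have "(\<lambda>x. f (g x) * g' x) absolutely_integrable_on S"
    by (rule back_subst) (intro set_integrable_cong refl cong)
  with meas show **: "set_integrable lborel S (\<lambda>x. f (g x) * g' x)"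
    unfolding set_integrable_def set_borel_measurable_def by (simp add: integrable_completion)
  show "(LINT x:S|lborel. f (g x) * g' x) = (LINT y:g ` S|lborel. f y)"
    using *(2) set_borel_integral_eq_integral(2)[OF **] set_borel_integral_eq_integral(2)[OF int]
    by (simp add: cong cong: Henstock_Kurzweil_Integration.integral_cong)
qed

section \<open>Increasing diffeomorphisms between intervals\<close>

locale interval_diffeo =
  fixes I J :: "real set" and \<psi> d\<psi> :: "real \<Rightarrow> real"
  assumes I: "nondegenerate_interval I" and J: "nondegenerate_interval J"
    and deriv: "t \<in> J \<Longrightarrow> (\<psi> has_real_derivative d\<psi> t) (at t within J)"
    and cont_deriv: "continuous_on J d\<psi>"
    and deriv_pos: "t \<in> J \<Longrightarrow> d\<psi> t > 0"
    and image: "\<psi> ` J = I"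
begin

lemma mem: "t \<in> J \<Longrightarrow> \<psi> t \<in> I"
  using image by blast

lemma deriv_nonzero: "t \<in> J \<Longrightarrow> d\<psi> t \<noteq> 0"
  using deriv_pos[of t] by simp

lemma cont: "continuous_on J \<psi>"
  using deriv by (auto simp: continuous_on_eq_continuous_within intro: DERIV_continuous)

lemma strict_mono: "s \<in> J \<Longrightarrow> t \<in> J \<Longrightarrow> s < t \<Longrightarrow> \<psi> s < \<psi> t"
proof (rule DERIV_pos_imp_increasing_open[of s t \<psi>])
  assume st: "s \<in> J" "t \<in> J" "s < t"
  then have sub: "{s..t} \<subseteq> J" using nondegenerate_interval_Icc_subset[OF J] by blast
  show "continuous_on {s..t} \<psi>" using cont sub by (rule continuous_on_subset)
  fix x assume x: "s < x" "x < t"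
  \<comment> \<open>At a point strictly between \<open>s\<close> and \<open>t\<close> the derivative
    within the interval is the two-sided one, as the mean value argument requires.\<close>
  then have "(\<psi> has_real_derivative d\<psi> x) (at x within {s..t})"
    using sub by (intro DERIV_subset[OF deriv]) auto
  then have "(\<psi> has_real_derivative d\<psi> x) (at x)"
    using x by (simp add: at_within_Icc_at)
  then show "\<exists>y. (\<psi> has_real_derivative y) (at x) \<and> y > 0"
    using deriv_pos[of x] subsetD[OF sub, of x] x by (intro exI[of _ "d\<psi> x"]) auto
qed

lemma le_iff: "s \<in> J \<Longrightarrow> t \<in> J \<Longrightarrow> \<psi> s \<le> \<psi> t \<longleftrightarrow> s \<le> t"
  by (metis strict_mono linorder_less_linear not_le order.strict_implies_order order_refl)

lemma less_iff: "s \<in> J \<Longrightarrow> t \<in> J \<Longrightarrow> \<psi> s < \<psi> t \<longleftrightarrow> s < t"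
  using le_iff by (metis not_le)

lemma inj: "inj_on \<psi> J"
  by (rule inj_onI) (metis le_iff antisym order_refl)

lemma image_Ioo:
  assumes "s \<in> J" "t \<in> J"
  shows "\<psi> ` {s<..<t} = {\<psi> s<..<\<psi> t}"
proof -
  have sub: "{s<..<t} \<subseteq> J"
    using nondegenerate_interval_Icc_subset[OF J assms] by force
  show ?thesis
  proof (intro equalityI subsetI)
    fix y assume y: "y \<in> {\<psi> s<..<\<psi> t}"
    then have "y \<in> I"
      using nondegenerate_interval_Icc_subset[OF I mem[OF assms(1)] mem[OF assms(2)]] by auto
    then obtain x where "x \<in> J" "y = \<psi> x" using image by blast
    then show "y \<in> \<psi> ` {s<..<t}" using y assms by (auto simp: less_iff)
  qed (use sub assms in \<open>auto simp: less_iff subset_iff\<close>)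
qed

text \<open>An increasing bijection sends a last point of \<open>J\<close> to a last point of
  \<open>I\<close> and conversely, so both filters approach from the same side. Continuity gives the
  limit, and strict monotonicity keeps the values on that side.\<close>

lemma filterlim_inward:
  assumes t: "t \<in> J"
  shows "filterlim \<psi> (inward I (\<psi> t)) (inward J t)"
proof -
  have lim: "(\<psi> \<longlongrightarrow> \<psi> t) (inward J t)"
    using cont t tendsto_mono[OF inward_le[OF J t]] by (auto simp: continuous_on_def)
  have ev: "eventually (\<lambda>s. s \<in> J) (inward J t)" by (rule eventually_inward_mem[OF J t])
  have last: "(\<forall>y\<in>I. y \<le> \<psi> t) \<longleftrightarrow> (\<forall>s\<in>J. s \<le> t)"
    using le_iff t by (auto simp flip: image)
  show ?thesis
  proof (cases "\<forall>s\<in>J. s \<le> t")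
    case True
    have J_eq: "inward J t = at_left t" and I_eq: "inward I (\<psi> t) = at_left (\<psi> t)"
      unfolding inward_eq[OF t] inward_eq[OF mem[OF t]] last by (rule if_P[OF True])+
    have "eventually (\<lambda>s. s < t) (at_left t)" by (simp add: eventually_at_filter)
    then have "eventually (\<lambda>s. \<psi> s < \<psi> t) (at_left t)"
      using ev unfolding J_eq by eventually_elim (simp add: less_iff t)
    then show ?thesis
      using lim unfolding J_eq I_eq by (simp add: filterlim_at eventually_mono)
  next
    case False
    have J_eq: "inward J t = at_right t" and I_eq: "inward I (\<psi> t) = at_right (\<psi> t)"
      unfolding inward_eq[OF t] inward_eq[OF mem[OF t]] last by (rule if_not_P[OF False])+
    have "eventually (\<lambda>s. t < s) (at_right t)" by (simp add: eventually_at_filter)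
    then have "eventually (\<lambda>s. \<psi> t < \<psi> s) (at_right t)"
      using ev unfolding J_eq by eventually_elim (simp add: less_iff t)
    then show ?thesis
      using lim unfolding J_eq I_eq by (simp add: filterlim_at eventually_mono)
  qed
qed

section \<open>Transport of one-sided continuity, measurability and generalized derivatives\<close>

lemma rc_funs_compose:
  assumes "f \<in> rc_funs I"
  shows "compose J f \<psi> \<in> rc_funs J"
  unfolding rc_funs_iff
proof (intro conjI ballI)
  fix t assume t: "t \<in> J"
  have "((\<lambda>s. f (\<psi> s)) \<longlongrightarrow> f (\<psi> t)) (inward J t)"
    using assms mem[OF t] filterlim_inward[OF t]
    by (auto simp: rc_funs_iff intro: filterlim_compose)
  then show "(compose J f \<psi> \<longlongrightarrow> compose J f \<psi> t) (inward J t)"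
  proof (rule Lim_transform_eventually[THEN tendsto_eq_rhs])
    show "eventually (\<lambda>s. f (\<psi> s) = compose J f \<psi> s) (inward J t)"
      using eventually_inward_mem[OF J t] by eventually_elim (simp add: compose_eq)
  qed (simp add: compose_eq t)
qed simp

lemma measurable_diffeo: "\<psi> \<in> restrict_space borel J \<rightarrow>\<^sub>M restrict_space borel I"
  using borel_measurable_continuous_on_restrict[OF cont] mem
  by (intro measurable_restrict_space2) (auto simp: space_restrict_space)

lemma borel_funs_compose:
  assumes "f \<in> borel_funs I"
  shows "compose J f \<psi> \<in> borel_funs J"
proof -
  have "(\<lambda>t. f (\<psi> t)) \<in> borel_measurable (restrict_space borel J)"
    using assms by (intro measurable_compose[OF measurable_diffeo]) (simp add: borel_funs_def)
  also have "?this \<longleftrightarrow> compose J f \<psi> \<in> borel_measurable (restrict_space borel J)"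
    by (rule measurable_cong) (simp add: space_restrict_space compose_eq)
  finally show ?thesis by (simp add: borel_funs_def)
qed

lemma borel_funs_compose_mult_deriv:
  assumes "g \<in> borel_funs I"
  shows "(\<lambda>t\<in>J. g (\<psi> t) * d\<psi> t) \<in> borel_funs J"
proof -
  have "(\<lambda>t. compose J g \<psi> t * d\<psi> t) \<in> borel_measurable (restrict_space borel J)"
    using borel_funs_compose[OF assms] borel_measurable_continuous_on_restrict[OF cont_deriv]
    by (simp add: borel_funs_def)
  also have "?this \<longleftrightarrow> (\<lambda>t\<in>J. g (\<psi> t) * d\<psi> t) \<in> borel_measurable (restrict_space borel J)"
    by (rule measurable_cong) (simp add: space_restrict_space compose_eq)
  finally show ?thesis by (simp add: borel_funs_def)
qed

text \<open>The factor \<open>d\<psi>\<close> cancels in the quotient by the new gauge function,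
  leaving the old quotient composed with \<open>\<psi>\<close>; this settles one-sided continuity.
  Substitution gives the integral identity.\<close>

lemma is_D_wrt_compose:
  assumes g: "is_D_wrt I w f g"
  shows "is_D_wrt J (\<lambda>t\<in>J. w (\<psi> t) * d\<psi> t) (compose J f \<psi>) (\<lambda>t\<in>J. g (\<psi> t) * d\<psi> t)"
    (is "is_D_wrt J ?w ?f ?g")
proof -
  have gB: "g \<in> borel_funs I" and rc: "(\<lambda>x\<in>I. g x / w x) \<in> rc_funs I"
    using g unfolding is_D_wrt_def rc_funs_wrt_def by blast+
  have gB': "?g \<in> borel_funs J" using gB by (rule borel_funs_compose_mult_deriv)
  have "(\<lambda>t\<in>J. ?g t / ?w t) = compose J (\<lambda>x\<in>I. g x / w x) \<psi>"
    using mem by (auto simp: compose_def fun_eq_iff deriv_nonzero)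
  then have rc': "?g \<in> rc_funs_wrt J ?w"
    using gB' rc_funs_compose[OF rc] by (simp add: rc_funs_wrt_def)
  have step: "set_integrable lborel {s<..<t} ?g \<and>
      ?f t - ?f s = (LINT u:{s<..<t}|lborel. ?g u)"
    if st: "s \<in> J" "t \<in> J" "s \<le> t" for s t
  proof -
    have sub: "{s<..<t} \<subseteq> J"
      using nondegenerate_interval_Icc_subset[OF J st(1,2)] by force
    have le: "\<psi> s \<le> \<psi> t" using st by (simp add: le_iff)
    note int = is_D_wrt_integral[OF g mem[OF st(1)] mem[OF st(2)] le]
    have cong: "g (\<psi> u) * d\<psi> u = ?g u" if "u \<in> {s<..<t}" for u
      using that sub by auto
    \<comment> \<open>Measurability is known for the extensional \<open>?g\<close>; it passes to the
      unrestricted product because the two agree on \<open>{s<..<t}\<close>.\<close>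
    have 0: "set_borel_measurable borel {s<..<t} ?g"
      by (rule set_borel_measurable_borel_funs[OF gB' _ sub]) simp
    then have 1: "set_borel_measurable borel {s<..<t} (\<lambda>u. g (\<psi> u) * d\<psi> u)"
      by (rule back_subst) (auto simp: set_borel_measurable_def fun_eq_iff indicator_def cong
          intro!: arg_cong[where f="\<lambda>h. h \<in> _"])
    have "set_integrable lborel (\<psi> ` {s<..<t}) g"
      using int(1) by (simp add: image_Ioo st)
    moreover have "(\<psi> has_real_derivative d\<psi> u) (at u within {s<..<t})" if "u \<in> {s<..<t}" for u
      using that sub by (intro DERIV_subset[OF deriv]) auto
    moreover have "d\<psi> u \<ge> 0" if "u \<in> {s<..<t}" for u
      using that sub by (intro less_imp_le deriv_pos) auto
    moreover have "inj_on \<psi> {s<..<t}" using inj sub by (rule inj_on_subset)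
    moreover have "\<psi> ` {s<..<t} \<in> sets borel" by (simp add: image_Ioo st)
    ultimately have "set_integrable lborel {s<..<t} (\<lambda>u. g (\<psi> u) * d\<psi> u)"
      "(LINT u:{s<..<t}|lborel. g (\<psi> u) * d\<psi> u) = (LINT y:\<psi> ` {s<..<t}|lborel. g y)"
      using 1 by (intro set_integral_change_of_variables; simp)+
    moreover have "set_integrable lborel {s<..<t} (\<lambda>u. g (\<psi> u) * d\<psi> u) \<longleftrightarrow>
        set_integrable lborel {s<..<t} ?g"
      by (intro set_integrable_cong refl cong)
    moreover have "(LINT u:{s<..<t}|lborel. g (\<psi> u) * d\<psi> u) = (LINT u:{s<..<t}|lborel. ?g u)"
      by (intro set_lebesgue_integral_cong) (auto simp: cong)
    ultimately show ?thesis
      using int(2) by (simp add: image_Ioo st compose_eq mem)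
  qed
  \<comment> \<open>The instance of \<open>step\<close> with \<open>s\<close> and \<open>t\<close>
    swapped handles reversed endpoints, where the interval integral changes sign.\<close>
  have int: "interval_lebesgue_integrable lborel (ereal s) (ereal t) ?g \<and>
      ?f t = ?f s + (LBINT u=ereal s..ereal t. ?g u)" if "s \<in> J" "t \<in> J" for s t
    using step[OF that] step[OF that(2,1)]
    by (cases s t rule: linorder_le_cases)
      (auto simp: interval_lebesgue_integrable_def interval_lebesgue_integral_def
        algebra_simps)
  show ?thesis
    unfolding is_D_wrt_def by (intro conjI ballI rc' int[THEN conjunct1] int[THEN conjunct2])
qed

text \<open>This is assertion (I). Membership and the derivative formula go through the induction
  together, since membership at level \<open>Suc j\<close> is a condition on the derivative of order
  \<open>j\<close>.\<close>

lemma gen_deriv_compose: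
  assumes w: "\<And>k x. x \<in> I \<Longrightarrow> w k x > 0"
    and v0: "v 0 = compose J (w 0) \<psi>"
    and v: "\<And>k. k \<ge> 1 \<Longrightarrow> v k = (\<lambda>t\<in>J. w k (\<psi> t) * d\<psi> t)"
    and f: "f \<in> gen_S I w j"
  shows "compose J f \<psi> \<in> gen_S J v j \<and>
    gen_deriv J v j (compose J f \<psi>) = compose J (gen_deriv I w j f) \<psi>"
  using f
proof (induction j)
  case 0
  then have "compose J f \<psi> \<in> borel_funs J" using borel_funs_compose by simp
  moreover have "gen_deriv J v 0 (compose J f \<psi>) = compose J (gen_deriv I w 0 f) \<psi>"
    using mem by (auto simp: v0 compose_def fun_eq_iff)
  ultimately show ?case unfolding gen_S.simps by (rule conjI)
next
  case (Suc j)
  let ?F = "gen_deriv I w j f" and ?w = "w (Suc j)" and ?v = "v (Suc j)"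
  from Suc have IH: "compose J f \<psi> \<in> gen_S J v j"
    "gen_deriv J v j (compose J f \<psi>) = compose J ?F \<psi>"
    and F: "?F \<in> S_wrt I ?w"
    by auto
  from F obtain g where g: "is_D_wrt I ?w ?F g" by (auto simp: S_wrt_def)
  have v_pos: "?v t > 0" if "t \<in> J" for t
    using that w mem deriv_pos by (simp add: v)
  have g': "is_D_wrt J ?v (compose J ?F \<psi>) (\<lambda>t\<in>J. g (\<psi> t) * d\<psi> t)"
    using is_D_wrt_compose[OF g] by (simp add: v)
  then have in_S: "compose J ?F \<psi> \<in> S_wrt J ?v"
    using F borel_funs_compose by (auto simp: S_wrt_def)
  have D_v: "D_wrt J ?v (compose J ?F \<psi>) = (\<lambda>t\<in>J. g (\<psi> t) * d\<psi> t)"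
    using J v_pos g' by (rule D_wrt_eqI)
  have D_w: "D_wrt I ?w ?F = g"
    using I w g by (rule D_wrt_eqI)
  \<comment> \<open>Both the numerator from \<open>D_v\<close> and the gauge function
    \<open>?v\<close> carry the factor \<open>d\<psi>\<close>, which is nonzero on \<open>J\<close>
    and cancels.\<close>
  have "gen_deriv J v (Suc j) (compose J f \<psi>) = compose J (gen_deriv I w (Suc j) f) \<psi>"
    unfolding gen_deriv.simps IH(2) D_v D_w
    by (rule ext) (simp add: v compose_def mem deriv_nonzero)
  then show ?case using IH in_S by (simp del: gen_deriv.simps)
qed

section \<open>The inverse diffeomorphism and bijectivity\<close>

abbreviation \<phi> :: "real \<Rightarrow> real" where
  "\<phi> \<equiv> inv_into J \<psi>"

text \<open>The locale is stable under exchanging the two intervals, so every transport result also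
  applies backwards.\<close>

lemma inverse: "interval_diffeo J I \<phi> (\<lambda>x. 1 / d\<psi> (\<phi> x))"
proof
  \<comment> \<open>A continuous injection of a path-connected set of reals is a homeomorphism onto
    its image; this yields continuity of \<open>\<phi>\<close>.\<close>
  have "path_connected J"
    using J by (simp add: nondegenerate_interval_def is_interval_path_connected)
  then obtain h where h: "homeomorphism J I \<psi> h"
    using homeomorphism_into_1d[OF _ cont image inj] by auto
  have "h x = \<phi> x" if "x \<in> I" for x
    using h that by (metis homeomorphism_def inv_into_f_f inj image_eqI)
  then have cont_inv: "continuous_on I \<phi>"
    using homeomorphism_cont2[OF h] continuous_on_cong by blast
  have \<phi>_mem: "\<phi> x \<in> J" and \<psi>_\<phi>: "\<psi> (\<phi> x) = x" if "x \<in> I" for x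
    using that by (simp_all add: inv_into_into f_inv_into_f flip: image)
  show "nondegenerate_interval J" "nondegenerate_interval I" by (fact J I)+
  show "1 / d\<psi> (\<phi> x) > 0" if "x \<in> I" for x
    using deriv_pos[OF \<phi>_mem[OF that]] by simp
  show "\<phi> ` I = J"
    using inv_into_image_cancel[OF inj order_refl] by (simp add: image)
  have "continuous_on I (\<lambda>x. d\<psi> (\<phi> x))"
    using \<phi>_mem by (intro continuous_on_compose2[OF cont_deriv cont_inv]) auto
  then show "continuous_on I (\<lambda>x. 1 / d\<psi> (\<phi> x))"
    using \<phi>_mem deriv_nonzero by (intro continuous_intros) auto
  fix x assume x: "x \<in> I"
  \<comment> \<open>By injectivity \<open>\<phi>\<close> avoids the value \<open>\<phi> x\<close>
    away from \<open>x\<close>. The reciprocal difference quotient of \<open>\<psi>\<close> at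
    \<open>\<phi> x\<close> can therefore be composed with \<open>\<phi>\<close>, and it becomes the
    difference quotient of \<open>\<phi>\<close> at \<open>x\<close>.\<close>
  have "filterlim \<phi> (at (\<phi> x) within J) (at x within I)"
    unfolding filterlim_at
  proof
    show "eventually (\<lambda>y. \<phi> y \<in> J \<and> \<phi> y \<noteq> \<phi> x) (at x within I)"
      unfolding eventually_at_filter using \<phi>_mem \<psi>_\<phi> x by (intro always_eventually) metis
    show "(\<phi> \<longlongrightarrow> \<phi> x) (at x within I)"
      using cont_inv x by (simp add: continuous_on_def)
  qed
  moreover have "((\<lambda>t. inverse ((\<psi> t - \<psi> (\<phi> x)) / (t - \<phi> x))) \<longlongrightarrow> inverse (d\<psi> (\<phi> x)))
      (at (\<phi> x) within J)"
    using deriv[OF \<phi>_mem[OF x]] deriv_pos[OF \<phi>_mem[OF x]]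
    by (intro tendsto_inverse) (auto simp: has_field_derivative_iff)
  ultimately have "((\<lambda>y. inverse ((\<psi> (\<phi> y) - \<psi> (\<phi> x)) / (\<phi> y - \<phi> x))) \<longlongrightarrow>
      inverse (d\<psi> (\<phi> x))) (at x within I)"
    by (rule filterlim_compose[rotated])
  then have "((\<lambda>y. (\<phi> y - \<phi> x) / (y - x)) \<longlongrightarrow> 1 / d\<psi> (\<phi> x)) (at x within I)"
    by (rule Lim_transform_eventually[THEN tendsto_eq_rhs])
      (auto simp: eventually_at_filter \<psi>_\<phi> x inverse_eq_divide)
  then show "(\<phi> has_real_derivative 1 / d\<psi> (\<phi> x)) (at x within I)"
    by (simp add: has_field_derivative_iff)
qed

lemma compose_inv: "f \<in> extensional I \<Longrightarrow> compose I (compose J f \<psi>) \<phi> = f"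
  by (rule extensionalityI[where A = I])
    (auto simp: compose_eq inv_into_into f_inv_into_f simp flip: image)

lemma inv_compose: "f \<in> extensional J \<Longrightarrow> compose J (compose I f \<phi>) \<psi> = f"
  by (rule extensionalityI[where A = J]) (auto simp: compose_eq mem inj)

text \<open>This is assertion (II). Composition with \<open>\<phi>\<close> is a two-sided inverse on
  extensional functions, and (I) for \<open>\<psi>\<close> and for \<open>\<phi>\<close> shows that
  each map lands in the right space.\<close>

lemma bij_betw_gen_S:
  assumes w: "\<And>k x. x \<in> I \<Longrightarrow> w k x > 0" and w_ext: "\<And>k. w k \<in> extensional I"
    and v0: "v 0 = compose J (w 0) \<psi>"
    and v: "\<And>k. k \<ge> 1 \<Longrightarrow> v k = (\<lambda>t\<in>J. w k (\<psi> t) * d\<psi> t)"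
  shows "bij_betw (\<lambda>f. compose J f \<psi>) (gen_S I w j) (gen_S J v j)"
proof (rule bij_betw_byWitness[where f' = "\<lambda>f. compose I f \<phi>"])
  have \<phi>_mem: "\<phi> x \<in> J" and \<psi>_\<phi>: "\<psi> (\<phi> x) = x" if "x \<in> I" for x
    using that by (simp_all add: inv_into_into f_inv_into_f flip: image)
  have v_pos: "v k t > 0" if "t \<in> J" for k t
    using that w mem deriv_pos by (cases "k = 0") (simp_all add: v0 v compose_eq)
  \<comment> \<open>The gauge functions \<open>w\<close> arise from \<open>v\<close> through
    \<open>\<phi>\<close> by the same rule that produced \<open>v\<close> from \<open>w\<close>, as
    (I) for the inverse requires.\<close>
  have "w k = (\<lambda>x\<in>I. v k (\<phi> x) * (1 / d\<psi> (\<phi> x)))" if "k \<ge> 1" for k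
    using that w_ext[of k]
    by (intro extensionalityI[where A = I]) (auto simp: v \<phi>_mem \<psi>_\<phi> deriv_nonzero)
  moreover have "w 0 = compose I (v 0) \<phi>"
    using w_ext by (simp add: v0 compose_inv)
  ultimately show "(\<lambda>f. compose I f \<phi>) ` gen_S J v j \<subseteq> gen_S I w j"
    using interval_diffeo.gen_deriv_compose[where w = v and v = w, OF inverse v_pos] by blast
  show "(\<lambda>f. compose J f \<psi>) ` gen_S I w j \<subseteq> gen_S J v j"
    using gen_deriv_compose[where w = w and v = v, OF w v0 v] by blast
  show "\<forall>f\<in>gen_S I w j. compose I (compose J f \<psi>) \<phi> = f"
    using gen_S_subset_borel_funs[of I w j] compose_inv by (auto simp: borel_funs_def)
  show "\<forall>f\<in>gen_S J v j. compose J (compose I f \<phi>) \<psi> = f"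
    using gen_S_subset_borel_funs[of J v j] inv_compose by (auto simp: borel_funs_def)
qed

end

theorem proposition2p1:
  fixes I I' :: "real set" and w w' :: "nat \<Rightarrow> real \<Rightarrow> real"
    and \<psi> d\<psi> :: "real \<Rightarrow> real" and j :: nat
  assumes "nondegenerate_interval I" and "nondegenerate_interval I'"
    and "gauge_seq I w"
    and "\<And>t. t \<in> I' \<Longrightarrow> (\<psi> has_real_derivative d\<psi> t) (at t within I')"
    and "continuous_on I' d\<psi>"
    and "\<And>t. t \<in> I' \<Longrightarrow> d\<psi> t > 0"
    and "\<psi> ` I' = I"
    and "w' 0 = compose I' (w 0) \<psi>"
    and "\<And>k. k \<ge> 1 \<Longrightarrow> w' k = (\<lambda>t\<in>I'. w k (\<psi> t) * d\<psi> t)"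
  shows "(\<forall>f \<in> gen_S I w j.
            compose I' f \<psi> \<in> gen_S I' w' j \<and>
            gen_deriv I' w' j (compose I' f \<psi>) = compose I' (gen_deriv I w j f) \<psi>) \<and>
         bij_betw (\<lambda>f. compose I' f \<psi>) (gen_S I w j) (gen_S I' w' j)"
proof -
  interpret interval_diffeo I I' \<psi> d\<psi>
    by unfold_locales (fact assms)+
  have w: "w k x > 0" if "x \<in> I" for k x
    using assms(3) that by (simp add: gauge_seq_def borel_funs_pos_def)
  have w_ext: "w k \<in> extensional I" for k
    using assms(3) by (simp add: gauge_seq_def borel_funs_pos_def borel_funs_def)
  show ?thesis
    using gen_deriv_compose[where w = w and v = w', OF w assms(8,9)]
      bij_betw_gen_S[where w = w and v = w', OF w w_ext assms(8,9)]
    by (intro conjI ballI) simp_all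
qed

end
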